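(* Any permutation $\sigma$ can be uniquely decomposed into a direct sum of the form \[ \sigma = \pi_1\oplus\ldots\oplus\pi_m\oplus\tau\oplus\pi_m\oplus\ldots\oplus\pi_1, \] where $m\geqslant 0$, the permutations $\pi_1,\ldots,\pi_m$ are non-self-overlapping, and $\tau$ is either empty or a non-self-overlapping permutation. (Uniqueness means that $m$, $\pi_1,\ldots,\pi_m$ and $\tau$ are determined by $\sigma$.)
   Context: $S_n$ denotes the set of permutations $\sigma=\sigma_1\ldots\sigma_n$ of $\{1,\ldots,n\}$. Two sequences of distinct integers $\pi_1\ldots\pi_k$ and $\tau_1\ldots\tau_k$ are isomorphic if $\pi_i>\pi_j\Leftrightarrow\tau_i>\tau_j$ for all $i,j$. A permutation $\sigma\in S_n$, $n\geqslant1$, is self-overlapping if there is an integer $1\leqslant k<n$ such that: (1) $\{1,\ldots,k\}$ is invariant under $\sigma$; (2) $\{n-k+1,\ldots,n\}$ is invariant under $\sigma$; (3) $\sigma_1\ldots\sigma_k$ and $\sigma_{n-k+1}\ldots\sigma_n$ are isomorphic. Otherwise $\sigma$ is non-self-overlapping. The empty permutation is considered neither self-overlapping nor non-self-overlapping. The direct sum of $\pi\in S_a$ and $\rho\in S_b$ is the permutation $\pi\oplus\rho\in S_{a+b}$ given by $(\pi\oplus\rho)(i)=\pi(i)$ for $1\leqslant i\leqslant a$ and $(\pi\oplus\rho)(i)=\rho(i-a)+a$ for $a+1\leqslant i\leqslant a+b$; this operation is associative and the empty permutation is neutral for it. *)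

theory Defs
  imports "HOL-Combinatorics.Multiset_Permutations"
begin

(* A permutation is represented by its one-line notation, so that it determines its size
   (the elements of S n are exactly the duplicate-free lists with entries 1, ..., n,
   and S 0 contains only the empty permutation []). *)
definition S :: "nat \<Rightarrow> nat list set" where
  "S n = permutations_of_set {1..n}"

(* List indices start at 0, positions of a permutation at 1. *)
definition entry :: "nat list \<Rightarrow> nat \<Rightarrow> nat" where
  "entry \<sigma> i = \<sigma> ! (i - 1)"

definition isomorphic :: "nat list \<Rightarrow> nat list \<Rightarrow> bool" where
  "isomorphic \<pi> \<tau> \<longleftrightarrow>
     distinct \<pi> \<and> distinct \<tau> \<and> length \<pi> = length \<tau> \<and>
     (\<forall>i<length \<pi>. \<forall>j<length \<pi>. \<pi> ! i > \<pi> ! j \<longleftrightarrow> \<tau> ! i > \<tau> ! j)"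

definition self_overlapping :: "nat list \<Rightarrow> bool" where
  "self_overlapping \<sigma> \<longleftrightarrow>
     (\<exists>n\<ge>1. \<sigma> \<in> S n \<and>
       (\<exists>k. 1 \<le> k \<and> k < n \<and>
          entry \<sigma> ` {1..k} \<subseteq> {1..k} \<and>
          entry \<sigma> ` {n - k + 1..n} \<subseteq> {n - k + 1..n} \<and>
          isomorphic (take k \<sigma>) (drop (n - k) \<sigma>)))"

definition non_self_overlapping :: "nat list \<Rightarrow> bool" where
  "non_self_overlapping \<sigma> \<longleftrightarrow> (\<exists>n\<ge>1. \<sigma> \<in> S n) \<and> \<not> self_overlapping \<sigma>"

definition direct_sum :: "nat list \<Rightarrow> nat list \<Rightarrow> nat list" (infixr \<open>\<oplus>\<close> 65) where
  "\<pi> \<oplus> \<rho> = \<pi> @ map (\<lambda>x. x + length \<pi>) \<rho>"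

definition direct_sums :: "nat list list \<Rightarrow> nat list" where
  "direct_sums \<pi>s = foldr (\<oplus>) \<pi>s []"

lemma length_S: "\<pi> \<in> S a \<Longrightarrow> length \<pi> = a"
  by (auto simp: S_def dest: length_finite_permutations_of_set)

lemma entry_direct_sum:
  assumes "\<pi> \<in> S a" "\<rho> \<in> S b"
  shows "1 \<le> i \<Longrightarrow> i \<le> a \<Longrightarrow> entry (\<pi> \<oplus> \<rho>) i = entry \<pi> i"
    and "a + 1 \<le> i \<Longrightarrow> i \<le> a + b \<Longrightarrow> entry (\<pi> \<oplus> \<rho>) i = entry \<rho> (i - a) + a"
  using length_S[OF assms(1)] length_S[OF assms(2)]
  by (auto simp: entry_def direct_sum_def nth_append)

lemma direct_sum_in_S:
  assumes "\<pi> \<in> S a" "\<rho> \<in> S b"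
  shows "\<pi> \<oplus> \<rho> \<in> S (a + b)"
proof -
  have "(\<lambda>x. x + a) ` {1..b} = {a + 1..a + b}"
    by (simp add: image_add_atLeastAtMost' add.commute)
  moreover have "{1..a + b} = {1..a} \<union> {a + 1..a + b}"
    by auto
  ultimately show ?thesis
    using assms length_S[OF assms(1)]
    by (auto simp: S_def permutations_of_set_def direct_sum_def distinct_map)
qed

lemma direct_sum_Nil [simp]: "[] \<oplus> \<rho> = \<rho>" "\<pi> \<oplus> [] = \<pi>"
  by (simp_all add: direct_sum_def)

lemma direct_sum_assoc: "(\<pi> \<oplus> \<rho>) \<oplus> \<tau> = \<pi> \<oplus> (\<rho> \<oplus> \<tau>)"
  by (simp add: direct_sum_def ac_simps)

end

theory Submission
  imports Defs
begin

text \<open>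
  Under \<open>\<oplus>\<close> the permutations form a cancellative monoid in which two factorizations of the same
  element always have a common refinement (\<open>direct_sum_refinement\<close>), just as for concatenation
  of words. In this monoid a permutation is self-overlapping exactly if it has a border: a
  nonempty proper direct summand that occurs both at its beginning and at its end
  (\<open>self_overlapping_iff_border\<close>). The theorem thus is the analogue for \<open>\<oplus>\<close> of a statement about
  unbordered words, and is proved in the same way.

  For existence, take a shortest border \<open>\<alpha>\<close> of \<open>\<sigma>\<close>, if there is one. Since borders of \<open>\<alpha>\<close> are
  borders of \<open>\<sigma>\<close>, it has none itself. Its two occurrences cannot overlap, because the overlap
  would be a border of \<open>\<alpha>\<close>. Hence \<open>\<sigma> = \<alpha> \<oplus> \<delta> \<oplus> \<alpha>\<close> (\<open>border_imp_peel\<close>), and \<open>\<delta>\<close> is decomposed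
  recursively.

  For uniqueness, let two decompositions of \<open>\<sigma>\<close> have the outermost summands \<open>\<pi>\<close> and \<open>\<pi>'\<close>. If
  \<open>\<pi>\<close> were shorter than \<open>\<pi>'\<close>, it would be a border of \<open>\<pi>'\<close>, by refinement at both ends of \<open>\<sigma>\<close>.
  Hence \<open>\<pi> = \<pi>'\<close>, and both ends cancel. If only one of the decompositions has an outermost pair,
  then \<open>\<sigma>\<close> has a border although it equals the center of the other, which has none.
\<close>

section \<open>Permutations as a monoid under direct sum\<close>

definition perm :: "nat list \<Rightarrow> bool" where
  "perm \<sigma> \<longleftrightarrow> \<sigma> \<in> S (length \<sigma>)"

lemma S_iff_perm: "\<sigma> \<in> S n \<longleftrightarrow> perm \<sigma> \<and> length \<sigma> = n"
  by (auto simp: perm_def dest: length_S)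

lemma perm_iff: "perm \<sigma> \<longleftrightarrow> distinct \<sigma> \<and> set \<sigma> = {1..length \<sigma>}"
  by (auto simp: perm_def S_def permutations_of_set_def)

lemma perm_Nil [simp]: "perm []"
  by (simp add: perm_iff)

lemma length_direct_sum [simp]: "length (\<pi> \<oplus> \<rho>) = length \<pi> + length \<rho>"
  by (simp add: direct_sum_def)

lemma direct_sum_eq_Nil_iff [simp]: "\<pi> \<oplus> \<rho> = [] \<longleftrightarrow> \<pi> = [] \<and> \<rho> = []"
  by (simp add: direct_sum_def)

lemma perm_direct_sum: "perm \<pi> \<Longrightarrow> perm \<rho> \<Longrightarrow> perm (\<pi> \<oplus> \<rho>)"
  using direct_sum_in_S by (simp add: perm_def)

lemma direct_sum_eq_append_conv:
  assumes "length \<pi> = length \<pi>'"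
  shows "\<pi> \<oplus> \<rho> = \<pi>' \<oplus> \<rho>' \<longleftrightarrow> \<pi> = \<pi>' \<and> \<rho> = \<rho>'"
proof -
  have "inj (\<lambda>x. x + length \<pi>)"
    by (simp add: inj_def)
  then show ?thesis
    using assms by (auto simp: direct_sum_def inj_map_eq_map)
qed

lemma direct_sum_left_cancel: "\<pi> \<oplus> \<rho> = \<pi> \<oplus> \<rho>' \<longleftrightarrow> \<rho> = \<rho>'"
  by (simp add: direct_sum_eq_append_conv)

lemma direct_sum_right_cancel: "\<pi> \<oplus> \<rho> = \<pi>' \<oplus> \<rho> \<longleftrightarrow> \<pi> = \<pi>'"
proof
  assume eq: "\<pi> \<oplus> \<rho> = \<pi>' \<oplus> \<rho>"
  then have "length (\<pi> \<oplus> \<rho>) = length (\<pi>' \<oplus> \<rho>)"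
    by (rule arg_cong)
  then have "length \<pi> = length \<pi>'"
    by simp
  then show "\<pi> = \<pi>'"
    using eq direct_sum_eq_append_conv by blast
qed simp

text \<open>
  An initial segment of \<open>k\<close> entries with values in \<open>{1..k}\<close> takes all these values, so the
  remaining entries are exactly the larger values and form a shifted permutation.
\<close>
lemma perm_split:
  assumes "perm \<sigma>" "k \<le> length \<sigma>" "set (take k \<sigma>) \<subseteq> {1..k}"
  obtains \<rho> where "perm (take k \<sigma>)" "perm \<rho>" "\<sigma> = take k \<sigma> \<oplus> \<rho>"
proof
  define \<rho> where "\<rho> = map (\<lambda>x. x - k) (drop k \<sigma>)"
  have dist: "distinct \<sigma>" and set: "set \<sigma> = {1..length \<sigma>}"
    using assms(1) by (simp_all add: perm_iff)
  have len: "length (take k \<sigma>) = k"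
    using assms(2) by simp
  have "card (set (take k \<sigma>)) = k"
    using dist len by (metis distinct_card distinct_take)
  then have take: "set (take k \<sigma>) = {1..k}"
    using assms(3) by (intro card_subset_eq) auto
  have drop: "set (drop k \<sigma>) = {k + 1..length \<sigma>}"
  proof -
    have "set (take k \<sigma>) \<union> set (drop k \<sigma>) = {1..length \<sigma>}"
      using set by (metis append_take_drop_id set_append)
    moreover have "set (take k \<sigma>) \<inter> set (drop k \<sigma>) = {}"
      using dist by (simp add: set_take_disj_set_drop_if_distinct)
    ultimately have "set (drop k \<sigma>) = {1..length \<sigma>} - set (take k \<sigma>)"
      by (metis Diff_triv Int_commute Un_Diff Diff_cancel sup_bot_left)
    also have "\<dots> = {k + 1..length \<sigma>}"
      unfolding take by auto
    finally show ?thesis .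
  qed
  show "perm (take k \<sigma>)"
    using dist take len by (simp add: perm_iff)
  have "inj_on (\<lambda>x. x - k) (set (drop k \<sigma>))"
    unfolding drop by (auto simp: inj_on_def)
  moreover have "(\<lambda>x. x - k) ` {k + 1..length \<sigma>} = {1..length \<sigma> - k}"
  proof
    show "{1..length \<sigma> - k} \<subseteq> (\<lambda>x. x - k) ` {k + 1..length \<sigma>}"
    proof
      fix y assume "y \<in> {1..length \<sigma> - k}"
      then show "y \<in> (\<lambda>x. x - k) ` {k + 1..length \<sigma>}"
        by (intro image_eqI[of _ _ "y + k"]) auto
    qed
  qed auto
  ultimately show "perm \<rho>"
    using dist drop by (simp add: perm_iff \<rho>_def distinct_map)
  have "map (\<lambda>x. x + k) \<rho> = drop k \<sigma>"
    unfolding \<rho>_def map_map by (rule map_idI) (use drop in auto)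
  then show "\<sigma> = take k \<sigma> \<oplus> \<rho>"
    using len by (simp add: direct_sum_def)
qed

text \<open>
  This is the analogue of Levi's lemma for words: the shorter left factor, being a permutation,
  splits off from the longer one.
\<close>
lemma direct_sum_refinement:
  assumes "\<pi> \<oplus> \<rho> = \<pi>' \<oplus> \<rho>'" "perm \<pi>" "perm \<pi>'" "length \<pi> \<le> length \<pi>'"
  obtains \<delta> where "perm \<delta>" "\<pi>' = \<pi> \<oplus> \<delta>" "\<rho> = \<delta> \<oplus> \<rho>'"
proof -
  have "take (length \<pi>) (\<pi> \<oplus> \<rho>) = take (length \<pi>) (\<pi>' \<oplus> \<rho>')"
    using assms(1) by simp
  then have take: "take (length \<pi>) \<pi>' = \<pi>"
    using assms(4) by (simp add: direct_sum_def)
  have "set \<pi> \<subseteq> {1..length \<pi>}"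
    using assms(2) by (simp add: perm_iff)
  then obtain \<delta> where \<delta>: "perm \<delta>" "\<pi>' = \<pi> \<oplus> \<delta>"
    using perm_split[OF assms(3,4)] take by metis
  then have "\<pi> \<oplus> \<rho> = \<pi> \<oplus> (\<delta> \<oplus> \<rho>')"
    using assms(1) by (simp add: direct_sum_assoc)
  then show ?thesis
    using that \<delta> by (simp add: direct_sum_left_cancel)
qed

section \<open>Isomorphic permutations\<close>

text \<open>
  The entries smaller than the value \<open>v\<close> are \<open>1, \<dots>, v - 1\<close>. So each entry can be read off from the
  relative order, which is all that an isomorphism preserves.
\<close>
lemma perm_nth_eq_card:
  assumes "perm \<sigma>" "i < length \<sigma>"
  shows "\<sigma> ! i = Suc (card {j. j < length \<sigma> \<and> \<sigma> ! j < \<sigma> ! i})"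
proof -
  let ?J = "{j. j < length \<sigma> \<and> \<sigma> ! j < \<sigma> ! i}"
  have dist: "distinct \<sigma>" and set: "set \<sigma> = {1..length \<sigma>}"
    using assms(1) by (simp_all add: perm_iff)
  have i: "\<sigma> ! i \<in> {1..length \<sigma>}"
    using assms(2) set nth_mem by blast
  have "(!) \<sigma> ` ?J = {x \<in> set \<sigma>. x < \<sigma> ! i}"
    by (auto simp: in_set_conv_nth)
  also have "\<dots> = {1..<\<sigma> ! i}"
    using i by (auto simp: set)
  finally have "card ((!) \<sigma> ` ?J) = \<sigma> ! i - 1"
    by simp
  moreover have "inj_on ((!) \<sigma>) ?J"
    using dist by (auto simp: inj_on_def nth_eq_iff_index_eq)
  ultimately have "card ?J = \<sigma> ! i - 1"
    by (simp add: card_image)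
  then show ?thesis
    using i by simp
qed

lemma isomorphic_perms_eq:
  assumes "perm \<pi>" "perm \<tau>" "isomorphic \<pi> \<tau>"
  shows "\<pi> = \<tau>"
proof (rule nth_equalityI)
  show len: "length \<pi> = length \<tau>"
    using assms(3) by (simp add: isomorphic_def)
  fix i assume i: "i < length \<pi>"
  have "{j. j < length \<pi> \<and> \<pi> ! j < \<pi> ! i} = {j. j < length \<tau> \<and> \<tau> ! j < \<tau> ! i}"
    using assms(3) i len unfolding isomorphic_def by auto
  then show "\<pi> ! i = \<tau> ! i"
    using perm_nth_eq_card[OF assms(1), of i] perm_nth_eq_card[OF assms(2), of i] i len by simp
qed

lemma isomorphic_shift:
  "isomorphic \<pi> (map (\<lambda>x. x + k) \<tau>) \<longleftrightarrow> isomorphic \<pi> \<tau>"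
  by (auto simp: isomorphic_def distinct_map inj_on_def)

section \<open>Borders\<close>

definition border :: "nat list \<Rightarrow> nat list \<Rightarrow> bool" where
  "border \<alpha> \<sigma> \<longleftrightarrow> \<alpha> \<noteq> [] \<and> \<alpha> \<noteq> \<sigma> \<and> perm \<alpha> \<and>
     (\<exists>\<mu> \<nu>. perm \<mu> \<and> perm \<nu> \<and> \<sigma> = \<alpha> \<oplus> \<mu> \<and> \<sigma> = \<nu> \<oplus> \<alpha>)"

lemma borderI:
  assumes "\<alpha> \<noteq> []" "\<alpha> \<noteq> \<sigma>" "perm \<alpha>" "perm \<mu>" "perm \<nu>" "\<sigma> = \<alpha> \<oplus> \<mu>" "\<sigma> = \<nu> \<oplus> \<alpha>"
  shows "border \<alpha> \<sigma>"
  using assms unfolding border_def by blast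

lemma borderE:
  assumes "border \<alpha> \<sigma>"
  obtains \<mu> \<nu> where "\<alpha> \<noteq> []" "perm \<alpha>" "perm \<mu>" "perm \<nu>"
    "\<sigma> = \<alpha> \<oplus> \<mu>" "\<sigma> = \<nu> \<oplus> \<alpha>" "\<mu> \<noteq> []" "\<nu> \<noteq> []"
  using assms unfolding border_def by (metis direct_sum_Nil)

lemma border_length: "border \<alpha> \<sigma> \<Longrightarrow> length \<alpha> < length \<sigma>"
  by (auto elim!: borderE)

lemma border_trans:
  assumes "border \<alpha> \<beta>" "border \<beta> \<sigma>"
  shows "border \<alpha> \<sigma>"
proof -
  obtain \<mu> \<nu> where 1: "\<alpha> \<noteq> []" "perm \<alpha>" "perm \<mu>" "perm \<nu>" "\<beta> = \<alpha> \<oplus> \<mu>" "\<beta> = \<nu> \<oplus> \<alpha>"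
    using assms(1) by (rule borderE)
  obtain \<mu>' \<nu>' where 2: "perm \<mu>'" "perm \<nu>'" "\<sigma> = \<beta> \<oplus> \<mu>'" "\<sigma> = \<nu>' \<oplus> \<beta>"
    using assms(2) by (rule borderE)
  show ?thesis
  proof (rule borderI[of _ _ "\<mu> \<oplus> \<mu>'" "\<nu>' \<oplus> \<nu>"])
    show "\<alpha> \<noteq> \<sigma>"
      using border_length[OF assms(1)] border_length[OF assms(2)] by auto
    show "\<sigma> = \<alpha> \<oplus> (\<mu> \<oplus> \<mu>')"
      using 1(5) 2(3) by (metis direct_sum_assoc)
    show "\<sigma> = (\<nu>' \<oplus> \<nu>) \<oplus> \<alpha>"
      using 1(6) 2(4) by (metis direct_sum_assoc)
  qed (use 1 2 in \<open>auto intro: perm_direct_sum\<close>)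
qed

lemma entry_image_prefix:
  assumes "k \<le> length \<sigma>"
  shows "entry \<sigma> ` {1..k} = set (take k \<sigma>)"
proof -
  have "entry \<sigma> ` {1..k} = entry \<sigma> ` Suc ` {0..<k}"
    by (simp only: image_Suc_atLeastLessThan One_nat_def atLeastLessThanSuc_atLeastAtMost)
  also have "\<dots> = (!) \<sigma> ` {0..<k}"
    by (simp only: image_image entry_def diff_Suc_1)
  finally show ?thesis
    using assms by (simp add: nth_image)
qed

lemma entry_image_suffix:
  assumes "k \<le> length \<sigma>"
  shows "entry \<sigma> ` {k + 1..length \<sigma>} = set (drop k \<sigma>)"
proof -
  have "entry \<sigma> ` {k + 1..length \<sigma>} = entry \<sigma> ` Suc ` {k..<length \<sigma>}"
    by (simp only: image_Suc_atLeastLessThan Suc_eq_plus1[symmetric]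
        atLeastLessThanSuc_atLeastAtMost)
  also have "\<dots> = (!) \<sigma> ` {k..<length \<sigma>}"
    by (simp only: image_image entry_def diff_Suc_1)
  also have "\<dots> = set (drop k \<sigma>)"
    by (auto simp: drop_eq_nths set_nths)
  finally show ?thesis .
qed

text \<open>
  Invariance of the first and of the last \<open>k\<close> positions makes both segments direct summands. An
  isomorphism between two permutations of the same size is an equality, so the two summands agree.
\<close>
lemma self_overlapping_iff_border:
  "self_overlapping \<sigma> \<longleftrightarrow> perm \<sigma> \<and> (\<exists>\<alpha>. border \<alpha> \<sigma>)"
proof
  assume "self_overlapping \<sigma>"
  then obtain k where \<sigma>: "perm \<sigma>" and k: "1 \<le> k" "k < length \<sigma>"
    and prefix: "entry \<sigma> ` {1..k} \<subseteq> {1..k}"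
    and suffix: "entry \<sigma> ` {length \<sigma> - k + 1..length \<sigma>} \<subseteq> {length \<sigma> - k + 1..length \<sigma>}"
    and iso: "isomorphic (take k \<sigma>) (drop (length \<sigma> - k) \<sigma>)"
    unfolding self_overlapping_def S_iff_perm by blast
  let ?l = "length \<sigma> - k"
  let ?\<alpha> = "take k \<sigma>"
  have "set ?\<alpha> \<subseteq> {1..k}"
    using prefix k entry_image_prefix[of k \<sigma>] by simp
  then obtain \<mu> where \<mu>: "perm ?\<alpha>" "perm \<mu>" "\<sigma> = ?\<alpha> \<oplus> \<mu>"
    using perm_split[OF \<sigma>, of k] k by auto
  have drop: "set (drop ?l \<sigma>) \<subseteq> {?l + 1..length \<sigma>}"
    using suffix entry_image_suffix[of ?l \<sigma>] by simp
  \<comment> \<open>The \<open>k\<close> entries of the suffix use up all values above \<open>?l\<close>.\<close>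
  have "card (set (drop ?l \<sigma>)) = length (drop ?l \<sigma>)"
    using \<sigma> by (intro distinct_card) (simp add: perm_iff)
  then have drop_eq: "set (drop ?l \<sigma>) = {?l + 1..length \<sigma>}"
    using k by (intro card_subset_eq drop) auto
  have "set (take ?l \<sigma>) \<inter> set (drop ?l \<sigma>) = {}"
    using \<sigma> by (simp add: perm_iff set_take_disj_set_drop_if_distinct)
  moreover have "set (take ?l \<sigma>) \<subseteq> {1..length \<sigma>}"
    using \<sigma> set_take_subset[of ?l \<sigma>] by (simp add: perm_iff)
  ultimately have "set (take ?l \<sigma>) \<subseteq> {1..length \<sigma>} - {?l + 1..length \<sigma>}"
    using drop_eq by blast
  also have "\<dots> \<subseteq> {1..?l}"
    by auto
  finally obtain \<alpha> where \<alpha>: "perm (take ?l \<sigma>)" "perm \<alpha>" "\<sigma> = take ?l \<sigma> \<oplus> \<alpha>"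
    using perm_split[OF \<sigma>, of ?l] by auto
  have "drop ?l \<sigma> = map (\<lambda>x. x + ?l) \<alpha>"
  proof -
    have "drop ?l (take ?l \<sigma> \<oplus> \<alpha>) = map (\<lambda>x. x + ?l) \<alpha>"
      by (simp add: direct_sum_def)
    then show ?thesis
      using \<alpha>(3) by simp
  qed
  then have "?\<alpha> = \<alpha>"
    using iso isomorphic_perms_eq[OF \<mu>(1) \<alpha>(2)] isomorphic_shift by metis
  moreover have "?\<alpha> \<noteq> []" "?\<alpha> \<noteq> \<sigma>"
    using k arg_cong[of ?\<alpha> \<sigma> length] by auto
  ultimately have "border \<alpha> \<sigma>"
    using borderI \<mu> \<alpha> by metis
  then show "perm \<sigma> \<and> (\<exists>\<alpha>. border \<alpha> \<sigma>)"
    using \<sigma> by blast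
next
  assume "perm \<sigma> \<and> (\<exists>\<alpha>. border \<alpha> \<sigma>)"
  then obtain \<alpha> where \<sigma>: "perm \<sigma>" and \<alpha>: "border \<alpha> \<sigma>"
    by blast
  then obtain \<mu> \<nu> where b: "\<alpha> \<noteq> []" "perm \<alpha>" "\<sigma> = \<alpha> \<oplus> \<mu>" "\<sigma> = \<nu> \<oplus> \<alpha>"
    by (blast elim: borderE)
  let ?k = "length \<alpha>"
  have k: "1 \<le> ?k" "?k < length \<sigma>"
    using b(1) border_length[OF \<alpha>] by (simp_all add: Suc_le_eq)
  have l: "length \<sigma> - ?k = length \<nu>" "length \<sigma> = length \<nu> + ?k"
    by (simp_all add: b(4))
  have take: "take ?k \<sigma> = \<alpha>"
    by (simp add: b(3) direct_sum_def)
  have drop: "drop (length \<nu>) \<sigma> = map (\<lambda>x. x + length \<nu>) \<alpha>"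
    by (simp add: b(4) direct_sum_def)
  have "isomorphic \<alpha> \<alpha>"
    using b(2) by (simp add: isomorphic_def perm_iff)
  then have "isomorphic (take ?k \<sigma>) (drop (length \<sigma> - ?k) \<sigma>)"
    by (simp add: take drop l(1) isomorphic_shift)
  moreover have "entry \<sigma> ` {1..?k} \<subseteq> {1..?k}"
    using b(2) k take entry_image_prefix[of ?k \<sigma>] by (simp add: perm_iff)
  moreover have "entry \<sigma> ` {length \<sigma> - ?k + 1..length \<sigma>} \<subseteq> {length \<sigma> - ?k + 1..length \<sigma>}"
  proof -
    have "entry \<sigma> ` {length \<nu> + 1..length \<sigma>} = (\<lambda>x. x + length \<nu>) ` {1..?k}"
      using entry_image_suffix[of "length \<nu>" \<sigma>] b(2) l(2) drop by (simp add: perm_iff)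
    also have "\<dots> \<subseteq> {length \<nu> + 1..length \<sigma>}"
      unfolding l(2) by auto
    finally show ?thesis
      unfolding l(1) .
  qed
  moreover have "1 \<le> length \<sigma>" "\<sigma> \<in> S (length \<sigma>)"
    using k \<sigma> by (auto simp: perm_def)
  ultimately show "self_overlapping \<sigma>"
    unfolding self_overlapping_def using k by blast
qed

lemma non_self_overlapping_iff:
  "non_self_overlapping \<sigma> \<longleftrightarrow> perm \<sigma> \<and> \<sigma> \<noteq> [] \<and> (\<nexists>\<alpha>. border \<alpha> \<sigma>)"
  unfolding non_self_overlapping_def self_overlapping_iff_border S_iff_perm
  by (auto simp: Suc_le_eq)

text \<open>
  A shortest border is itself without border, by transitivity. Its two occurrences do not overlap,
  since refinement would exhibit the overlap \<open>\<delta>\<close> as a shorter border.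
\<close>
lemma border_imp_peel:
  assumes "border \<beta> \<sigma>"
  obtains \<alpha> \<delta> where "non_self_overlapping \<alpha>" "perm \<delta>" "\<sigma> = \<alpha> \<oplus> \<delta> \<oplus> \<alpha>"
proof -
  obtain \<alpha> where \<alpha>: "border \<alpha> \<sigma>" and least: "\<And>\<gamma>. border \<gamma> \<sigma> \<Longrightarrow> length \<alpha> \<le> length \<gamma>"
    using exists_least_iff[of "\<lambda>n. \<exists>\<gamma>. border \<gamma> \<sigma> \<and> length \<gamma> = n"] assms
    by (metis not_le_imp_less)
  then obtain \<mu> \<nu> where b: "\<alpha> \<noteq> []" "perm \<alpha>" "perm \<mu>" "perm \<nu>" "\<sigma> = \<alpha> \<oplus> \<mu>" "\<sigma> = \<nu> \<oplus> \<alpha>" "\<nu> \<noteq> []"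
    by (blast elim: borderE)
  have unbordered: "\<not> border \<gamma> \<alpha>" for \<gamma>
    using border_trans[OF _ \<alpha>] border_length least by (meson not_le)
  have eq: "\<alpha> \<oplus> \<mu> = \<nu> \<oplus> \<alpha>"
    using b(5,6) by simp
  have "length \<alpha> \<le> length \<nu>"
  proof (rule ccontr)
    assume less: "\<not> length \<alpha> \<le> length \<nu>"
    then obtain \<delta> where \<delta>: "perm \<delta>" "\<alpha> = \<nu> \<oplus> \<delta>" "\<alpha> = \<delta> \<oplus> \<mu>"
      using direct_sum_refinement[OF eq[symmetric] b(4,2)] by auto
    have "length \<alpha> = length \<nu> + length \<delta>"
      using arg_cong[OF \<delta>(2), of length] by simp
    then have "\<delta> \<noteq> []" "\<delta> \<noteq> \<alpha>"
      using less b(7) by auto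
    then have "border \<delta> \<alpha>"
      using \<delta> b(3,4) by (auto intro: borderI)
    then show False
      using unbordered by blast
  qed
  then obtain \<delta> where \<delta>: "perm \<delta>" "\<nu> = \<alpha> \<oplus> \<delta>"
    using direct_sum_refinement[OF eq b(2,4)] by auto
  show ?thesis
  proof (rule that)
    show "non_self_overlapping \<alpha>"
      using b(1,2) unbordered by (simp add: non_self_overlapping_iff)
    show "\<sigma> = \<alpha> \<oplus> \<delta> \<oplus> \<alpha>"
      using b(6) \<delta>(2) by (simp add: direct_sum_assoc)
  qed (rule \<delta>(1))
qed

section \<open>Palindromic decompositions\<close>

abbreviation decomposition :: "nat list \<Rightarrow> nat list list \<Rightarrow> nat list \<Rightarrow> bool" where
  "decomposition \<sigma> \<pi>s \<tau> \<equiv>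
     (\<forall>\<pi>\<in>set \<pi>s. non_self_overlapping \<pi>) \<and> (\<tau> = [] \<or> non_self_overlapping \<tau>) \<and>
     \<sigma> = direct_sums (\<pi>s @ [\<tau>] @ rev \<pi>s)"

lemma direct_sums_Nil [simp]: "direct_sums [] = []"
  by (simp add: direct_sums_def)

lemma direct_sums_Cons [simp]: "direct_sums (\<pi> # \<pi>s) = \<pi> \<oplus> direct_sums \<pi>s"
  by (simp add: direct_sums_def)

lemma direct_sums_append [simp]: "direct_sums (\<pi>s @ \<rho>s) = direct_sums \<pi>s \<oplus> direct_sums \<rho>s"
  by (induction \<pi>s) (simp_all add: direct_sum_assoc)

lemma direct_sums_palindrome_Cons:
  "direct_sums ((\<pi> # \<pi>s) @ [\<tau>] @ rev (\<pi> # \<pi>s)) = \<pi> \<oplus> direct_sums (\<pi>s @ [\<tau>] @ rev \<pi>s) \<oplus> \<pi>"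
  by (simp add: direct_sum_assoc)

lemma perm_direct_sums: "\<forall>\<pi>\<in>set \<pi>s. perm \<pi> \<Longrightarrow> perm (direct_sums \<pi>s)"
  by (induction \<pi>s) (auto intro: perm_direct_sum)

lemma decomposition_perm: "decomposition \<sigma> \<pi>s \<tau> \<Longrightarrow> perm \<sigma>"
  using perm_direct_sums[of "\<pi>s @ [\<tau>] @ rev \<pi>s"] by (auto simp: non_self_overlapping_iff)

lemma decomposition_exists:
  assumes "perm \<sigma>"
  shows "\<exists>\<pi>s \<tau>. decomposition \<sigma> \<pi>s \<tau>"
  using assms
proof (induction "length \<sigma>" arbitrary: \<sigma> rule: less_induct)
  case less
  show ?case
  proof (cases "\<exists>\<beta>. border \<beta> \<sigma>")
    case False
    then have "decomposition \<sigma> [] \<sigma>"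
      using less.prems by (auto simp: non_self_overlapping_iff)
    then show ?thesis
      by blast
  next
    case True
    then obtain \<alpha> \<delta> where \<alpha>: "non_self_overlapping \<alpha>" and \<delta>: "perm \<delta>" "\<sigma> = \<alpha> \<oplus> \<delta> \<oplus> \<alpha>"
      using border_imp_peel by blast
    then have "length \<delta> < length \<sigma>"
      by (auto simp: non_self_overlapping_iff)
    then obtain \<pi>s \<tau> where "decomposition \<delta> \<pi>s \<tau>"
      using less.hyps \<delta>(1) by blast
    then have "decomposition \<sigma> (\<alpha> # \<pi>s) \<tau>"
      using \<alpha> \<delta>(2) unfolding direct_sums_palindrome_Cons by simp
    then show ?thesis
      by blast
  qed
qed

lemma border_of_ends:
  assumes "perm \<pi>" "perm \<delta>" "\<pi> \<noteq> []"
  shows "border \<pi> (\<pi> \<oplus> \<delta> \<oplus> \<pi>)"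
proof (rule borderI[of _ _ "\<delta> \<oplus> \<pi>" "\<pi> \<oplus> \<delta>"])
  show "\<pi> \<noteq> \<pi> \<oplus> \<delta> \<oplus> \<pi>"
  proof
    assume "\<pi> = \<pi> \<oplus> \<delta> \<oplus> \<pi>"
    then have "length \<pi> = length (\<pi> \<oplus> \<delta> \<oplus> \<pi>)"
      by (rule arg_cong)
    then show False
      using assms(3) by simp
  qed
qed (use assms in \<open>auto intro: perm_direct_sum simp: direct_sum_assoc\<close>)

text \<open>
  A shorter end would be split off from the longer one at the left end of the permutation and at
  its right end, and so be a border of it.
\<close>
lemma unbordered_end_not_longer:
  assumes "\<pi> \<oplus> \<delta> \<oplus> \<pi> = \<pi>' \<oplus> \<delta>' \<oplus> \<pi>'"
    and "non_self_overlapping \<pi>" "non_self_overlapping \<pi>'" "perm \<delta>" "perm \<delta>'"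
  shows "length \<pi>' \<le> length \<pi>"
proof (rule ccontr)
  assume less: "\<not> length \<pi>' \<le> length \<pi>"
  have perm: "perm \<pi>" "perm \<pi>'" "\<pi> \<noteq> []"
    using assms by (simp_all add: non_self_overlapping_iff)
  obtain \<mu> where \<mu>: "perm \<mu>" "\<pi>' = \<pi> \<oplus> \<mu>"
    using direct_sum_refinement[OF assms(1) perm(1,2)] less by auto
  have "(\<pi>' \<oplus> \<delta>') \<oplus> \<pi>' = (\<pi> \<oplus> \<delta>) \<oplus> \<pi>"
    using assms(1) by (simp add: direct_sum_assoc)
  moreover have "length (\<pi>' \<oplus> \<delta>') \<le> length (\<pi> \<oplus> \<delta>)"
    using less arg_cong[OF assms(1), of length] by simp
  ultimately obtain \<nu> where \<nu>: "perm \<nu>" "\<pi>' = \<nu> \<oplus> \<pi>"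
    using direct_sum_refinement perm_direct_sum perm assms(4,5) by metis
  have "border \<pi> \<pi>'"
    using borderI[OF perm(3) _ perm(1) \<mu>(1) \<nu>(1) \<mu>(2) \<nu>(2)] less by auto
  then show False
    using assms(3) by (auto simp: non_self_overlapping_iff)
qed

lemma decomposition_Cons_border:
  assumes "decomposition \<sigma> (\<pi> # \<pi>s) \<tau>"
  shows "border \<pi> \<sigma>"
proof -
  have "perm (direct_sums (\<pi>s @ [\<tau>] @ rev \<pi>s))"
    using assms by (intro decomposition_perm[of \<pi>s \<tau>]) simp
  moreover have "perm \<pi>" "\<pi> \<noteq> []"
    using assms by (simp_all add: non_self_overlapping_iff)
  ultimately show ?thesis
    using assms border_of_ends unfolding direct_sums_palindrome_Cons by blast
qed

lemma border_imp_decomposition_Cons: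
  assumes "decomposition \<sigma> \<pi>s \<tau>" "border \<beta> \<sigma>"
  shows "\<pi>s \<noteq> []"
proof
  assume "\<pi>s = []"
  then have "\<sigma> = \<tau>"
    using assms(1) by simp
  then show False
    using assms border_length[OF assms(2)] by (auto simp: non_self_overlapping_iff)
qed

lemma decomposition_unique:
  assumes "decomposition \<sigma> \<pi>s \<tau>" "decomposition \<sigma> \<pi>s' \<tau>'"
  shows "\<pi>s = \<pi>s' \<and> \<tau> = \<tau>'"
  using assms
proof (induction \<pi>s arbitrary: \<sigma> \<pi>s')
  case Nil
  have "\<pi>s' = []"
  proof (cases \<pi>s')
    case (Cons \<pi>' \<rho>s')
    then show ?thesis
      using border_imp_decomposition_Cons[OF Nil.prems(1)] decomposition_Cons_border Nil.prems(2)
      by blast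
  qed simp
  then show ?case
    using Nil.prems by simp
next
  case (Cons \<pi> \<rho>s)
  obtain \<pi>' \<rho>s' where \<pi>s': "\<pi>s' = \<pi>' # \<rho>s'"
    using border_imp_decomposition_Cons[OF Cons.prems(2) decomposition_Cons_border[OF Cons.prems(1)]]
    by (auto simp: neq_Nil_conv)
  define \<delta> where "\<delta> = direct_sums (\<rho>s @ [\<tau>] @ rev \<rho>s)"
  define \<delta>' where "\<delta>' = direct_sums (\<rho>s' @ [\<tau>'] @ rev \<rho>s')"
  have dec: "decomposition \<delta> \<rho>s \<tau>" and dec': "decomposition \<delta>' \<rho>s' \<tau>'"
    using Cons.prems by (simp_all add: \<pi>s' \<delta>_def \<delta>'_def)
  have perm: "perm \<delta>" "perm \<delta>'"
    using decomposition_perm[OF dec] decomposition_perm[OF dec'] by blast+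
  have nso: "non_self_overlapping \<pi>" "non_self_overlapping \<pi>'"
    using Cons.prems by (simp_all add: \<pi>s')
  have eq: "\<pi> \<oplus> \<delta> \<oplus> \<pi> = \<pi>' \<oplus> \<delta>' \<oplus> \<pi>'"
    using Cons.prems unfolding \<pi>s' direct_sums_palindrome_Cons \<delta>_def \<delta>'_def by metis
  have "length \<pi> = length \<pi>'"
    using unbordered_end_not_longer[OF eq nso perm]
      unbordered_end_not_longer[OF eq[symmetric] nso(2,1) perm(2,1)] by simp
  then have "\<pi> = \<pi>'" "\<delta> = \<delta>'"
    using eq direct_sum_eq_append_conv direct_sum_right_cancel by metis+
  then show ?case
    using Cons.IH[OF dec, of \<rho>s'] dec' \<pi>s' by simp
qed

theorem theorem2p4:
  fixes n :: nat and \<sigma> :: "nat list"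
  assumes "\<sigma> \<in> S n"
  shows "\<exists>!(\<pi>s, \<tau>).
           (\<forall>\<pi>\<in>set \<pi>s. non_self_overlapping \<pi>) \<and>
           (\<tau> = [] \<or> non_self_overlapping \<tau>) \<and>
           \<sigma> = direct_sums (\<pi>s @ [\<tau>] @ rev \<pi>s)"
proof -
  have "perm \<sigma>"
    using assms by (simp add: S_iff_perm)
  then obtain \<pi>s \<tau> where dec: "decomposition \<sigma> \<pi>s \<tau>"
    using decomposition_exists by blast
  show ?thesis
  proof (rule ex1I[of _ "(\<pi>s, \<tau>)"])
    show "case (\<pi>s, \<tau>) of (\<pi>s, \<tau>) \<Rightarrow> decomposition \<sigma> \<pi>s \<tau>"
      unfolding prod.case by (rule dec)
  next
    fix p assume p: "case p of (\<pi>s, \<tau>) \<Rightarrow> decomposition \<sigma> \<pi>s \<tau>"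
    obtain \<pi>s' \<tau>' where [simp]: "p = (\<pi>s', \<tau>')"
      by (rule prod.exhaust)
    have "decomposition \<sigma> \<pi>s' \<tau>'"
      using p unfolding \<open>p = _\<close> prod.case .
    from decomposition_unique[OF dec this] show "p = (\<pi>s, \<tau>)"
      by simp
  qed
qed

end
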